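(* Let $R$ be a commutative ring with non-zero identity, let $I$ be a proper ideal of $R$, and let $n\ge 1$ be an integer. Let $P$ be an $n$-absorbing $I$-primary ideal of $R$ such that $\sqrt{IP} = I\sqrt{P}$. Then $\sqrt{P}$ is an $n$-absorbing $I$-primary ideal of $R$.
   Context: For an ideal $P$ of a commutative ring $R$, $\sqrt{P}$ denotes the radical of $P$. The notation $b_1\cdots\widehat{b_i}\cdots b_m$ means that the factor $b_i$ is omitted from the product $b_1\cdots b_m$. $P - IP$ denotes set difference. For a fixed proper ideal $I$ of $R$ and an integer $n \ge 1$, a proper ideal $P$ of $R$ is called an $n$-absorbing $I$-primary ideal if whenever $b_1,\dots,b_{n+1}\in R$ satisfy $b_1\cdots b_{n+1}\in P - IP$, then $b_1\cdots b_n\in P$ or $b_1\cdots\widehat{b_i}\cdots b_{n+1}\in\sqrt{P}$ for some $i\in\{1,\dots,n\}$. *)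

theory Defs
  imports "HOL-Algebra.Ideal_Product"
begin

definition radical :: "('a, 'm) ring_scheme \<Rightarrow> 'a set \<Rightarrow> 'a set" where
  "radical R P = {x \<in> carrier R. \<exists>k::nat. 1 \<le> k \<and> x [^]\<^bsub>R\<^esub> k \<in> P}"

text \<open>
  The factors \<open>b\<^sub>1, \<dots>, b\<^sub>n\<^sub>+\<^sub>1\<close> are the values of a function on the index set \<open>{1..n + 1}\<close>; its
  values outside that set are irrelevant, and omitting a factor means deleting its index.
  The standing assumptions that \<open>I\<close> is a proper ideal of the commutative ring \<open>R\<close> and that
  \<open>n \<ge> 1\<close> are not part of the definition.
\<close>

definition n_absorbing_I_primary ::
  "nat \<Rightarrow> 'a set \<Rightarrow> 'a set \<Rightarrow> ('a, 'm) ring_scheme \<Rightarrow> bool" where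
  "n_absorbing_I_primary n I P R \<longleftrightarrow>
     ideal P R \<and> P \<noteq> carrier R \<and>
     (\<forall>b :: nat \<Rightarrow> 'a. b \<in> {1..n + 1} \<rightarrow> carrier R \<longrightarrow>
        (\<Otimes>\<^bsub>R\<^esub>j\<in>{1..n + 1}. b j) \<in> P - ideal_prod R I P \<longrightarrow>
        (\<Otimes>\<^bsub>R\<^esub>j\<in>{1..n}. b j) \<in> P \<or>
        (\<exists>i\<in>{1..n}. (\<Otimes>\<^bsub>R\<^esub>j\<in>{1..n + 1} - {i}. b j) \<in> radical R P))"

end

theory Submission
  imports Defs
begin

text \<open>
  The defining condition for \<open>P\<close> is stable under passing to powers. If a product \<open>x\<close> of
  \<open>n + 1\<close> elements \<open>b j\<close> lies in the radical of \<open>P\<close>, then \<open>x ^ k\<close>, the product of the powers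
  \<open>b j ^ k\<close>, lies in \<open>P\<close> for some \<open>k \<ge> 1\<close>. If moreover \<open>x\<close> is outside \<open>I \<sqdot> \<surd>P = \<surd>(I \<sqdot> P)\<close>,
  then no positive power of \<open>x\<close> lies in \<open>I \<sqdot> P\<close>; this is the one place where the equation between
  the two ideals enters. So the hypothesis on \<open>P\<close> applies to the powers \<open>b j ^ k\<close>, and each of
  its alternatives says that the \<open>k\<close>-th power of a subproduct of the \<open>b j\<close> lies in \<open>P\<close> or in
  its radical (lemma \<open>finprod_nat_pow\<close>), so that the subproduct itself lies one radical further
  up, which is exactly what is asked.

  It remains that the radical of a proper ideal is a proper ideal, for which closure under addition
  is the only issue (lemma \<open>mult_add_pow_mem\<close>).
\<close>

lemma (in comm_monoid) finprod_nat_pow: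
  assumes "f \<in> A \<rightarrow> carrier G"
  shows "(\<Otimes>j\<in>A. f j [^] (k::nat)) = (\<Otimes>j\<in>A. f j) [^] k"
proof (induction k)
  case 0
  show ?case by simp
next
  case (Suc k)
  have "(\<lambda>j. f j [^] k) \<in> A \<rightarrow> carrier G"
    using assms by auto
  then have "(\<Otimes>j\<in>A. f j [^] k \<otimes> f j) = (\<Otimes>j\<in>A. f j [^] k) \<otimes> (\<Otimes>j\<in>A. f j)"
    using assms by (rule finprod_multf)
  then show ?case
    using Suc.IH by simp
qed

text \<open>
  A form of the binomial argument without binomial coefficients. The extra factor \<open>a\<close>
  makes the induction work: splitting off one factor \<open>x \<oplus> y\<close> leaves two terms in which \<open>a\<close> is
  replaced by \<open>a \<otimes> x\<close> and \<open>a \<otimes> y\<close>, and the required exponent of \<open>x\<close> or of \<open>y\<close>, respectively,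
  drops by one.
\<close>

lemma (in cring) mult_add_pow_mem:
  fixes k m :: nat
  assumes P: "ideal P R"
    and xy: "x \<in> carrier R" "y \<in> carrier R"
    and "a \<in> carrier R" "a \<otimes> x [^] k \<in> P" "a \<otimes> y [^] m \<in> P"
  shows "a \<otimes> (x \<oplus> y) [^] (k + m) \<in> P"
  using assms(4-)
proof (induction "k + m" arbitrary: k m a)
  case 0
  then show ?case by simp
next
  case (Suc s)
  interpret P: ideal P R by (rule P)
  note a = \<open>a \<in> carrier R\<close>
  show ?case
  proof (cases "k = 0 \<or> m = 0")
    case True
    then have "a \<in> P"
      using Suc.prems by auto
    then show ?thesis
      using xy by (simp add: P.I_r_closed)
  next
    case False
    then obtain k' m' where k: "k = Suc k'" and m: "m = Suc m'"
      by (metis not0_implies_Suc)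
    have "(a \<otimes> x) \<otimes> y [^] m = x \<otimes> (a \<otimes> y [^] m)"
      using a xy by (simp add: m_ac)
    moreover have "(a \<otimes> x) \<otimes> x [^] k' = a \<otimes> x [^] k"
      using a xy by (simp add: k m_ac)
    ultimately have "(a \<otimes> x) \<otimes> (x \<oplus> y) [^] (k' + m) \<in> P"
      using Suc.hyps Suc.prems a xy k by (simp add: P.I_l_closed)
    moreover have "(a \<otimes> y) \<otimes> x [^] k = y \<otimes> (a \<otimes> x [^] k)"
      using a xy by (simp add: m_ac)
    moreover have "(a \<otimes> y) \<otimes> y [^] m' = a \<otimes> y [^] m"
      using a xy by (simp add: m m_ac)
    ultimately have *: "(a \<otimes> x) \<otimes> (x \<oplus> y) [^] s \<in> P" "(a \<otimes> y) \<otimes> (x \<oplus> y) [^] s \<in> P"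
      using Suc.hyps(1)[of k m' "a \<otimes> y"] Suc.hyps(2) Suc.prems a xy k m
      by (simp_all add: P.I_l_closed)
    have "a \<otimes> (x \<oplus> y) [^] (k + m) = (a \<otimes> x) \<otimes> (x \<oplus> y) [^] s \<oplus> (a \<otimes> y) \<otimes> (x \<oplus> y) [^] s"
    proof -
      have c: "(x \<oplus> y) [^] s \<in> carrier R"
        using xy by simp
      have "a \<otimes> (x \<oplus> y) [^] (k + m) = a \<otimes> ((x \<oplus> y) [^] s \<otimes> (x \<oplus> y))"
        by (simp flip: Suc.hyps(2))
      also have "\<dots> = (a \<otimes> x) \<otimes> (x \<oplus> y) [^] s \<oplus> (a \<otimes> y) \<otimes> (x \<oplus> y) [^] s"
        using a xy c by (simp add: l_distr r_distr m_ac)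
      finally show ?thesis .
    qed
    with * show ?thesis
      by simp
  qed
qed

lemma radicalI:
  fixes k :: nat
  assumes "x \<in> carrier R" "1 \<le> k" "x [^]\<^bsub>R\<^esub> k \<in> P"
  shows "x \<in> radical R P"
  using assms by (auto simp: radical_def)

lemma radicalE:
  assumes "x \<in> radical R P"
  obtains k :: nat where "x \<in> carrier R" "1 \<le> k" "x [^]\<^bsub>R\<^esub> k \<in> P"
  using assms by (auto simp: radical_def)

lemma (in cring) radical_ideal:
  assumes "ideal P R"
  shows "ideal (radical R P) R"
proof -
  interpret P: ideal P R by fact
  have mult: "a \<otimes> x \<in> radical R P" if x: "x \<in> radical R P" and a: "a \<in> carrier R" for a x
  proof -
    from x obtain k :: nat where k: "x \<in> carrier R" "1 \<le> k" "x [^] k \<in> P"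
      by (rule radicalE)
    then have "(a \<otimes> x) [^] k \<in> P"
      using a by (simp add: nat_pow_distrib P.I_l_closed)
    then show ?thesis
      using k a by (intro radicalI[where k = k]) auto
  qed
  have add: "x \<oplus> y \<in> radical R P" if x: "x \<in> radical R P" and y: "y \<in> radical R P" for x y
  proof -
    from x obtain k :: nat where k: "x \<in> carrier R" "1 \<le> k" "x [^] k \<in> P"
      by (rule radicalE)
    from y obtain m :: nat where m: "y \<in> carrier R" "1 \<le> m" "y [^] m \<in> P"
      by (rule radicalE)
    have "\<one> \<otimes> (x \<oplus> y) [^] (k + m) \<in> P"
      using k m assms by (intro mult_add_pow_mem) auto
    then show ?thesis
      using k m by (intro radicalI[where k = "k + m"]) auto
  qed
  have zero: "\<zero> \<in> radical R P"
    by (rule radicalI[where k = 1]) auto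
  have sub: "x \<in> carrier R" if "x \<in> radical R P" for x
    using that by (rule radicalE)
  have neg: "\<ominus> x \<in> radical R P" if "x \<in> radical R P" for x
    using mult[OF that, of "\<ominus> \<one>"] sub[OF that] by (simp add: l_minus)
  show ?thesis
  proof (rule idealI)
    show "ring R" by (rule ring_axioms)
    show "subgroup (radical R P) (add_monoid R)"
      using add zero sub neg by (intro add.subgroupI) (auto simp: a_inv_def)
    show "x \<otimes> a \<in> radical R P" "a \<otimes> x \<in> radical R P"
      if "a \<in> radical R P" "x \<in> carrier R" for a x
      using mult[OF that] sub[OF that(1)] that(2) by (simp_all add: m_comm)
  qed
qed

lemma (in cring) radical_proper:
  assumes "ideal P R" "P \<noteq> carrier R"
  shows "radical R P \<noteq> carrier R"
proof
  assume "radical R P = carrier R"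
  then have "\<one> \<in> radical R P"
    by simp
  then have "\<one> \<in> P"
    by (auto elim: radicalE)
  with assms show False
    using ideal.one_imp_carrier by blast
qed

theorem proposition2p4:
  fixes R :: "('a, 'm) ring_scheme" and I P :: "'a set" and n :: nat
  assumes "cring R" and "\<one>\<^bsub>R\<^esub> \<noteq> \<zero>\<^bsub>R\<^esub>"
    and "ideal I R" and "I \<noteq> carrier R"
    and "1 \<le> n"
    and "n_absorbing_I_primary n I P R"
    and "radical R (ideal_prod R I P) = ideal_prod R I (radical R P)"
  shows "n_absorbing_I_primary n I (radical R P) R"
proof -
  interpret cring R by fact
  have P: "ideal P R" "P \<noteq> carrier R"
    using assms(6) by (auto simp: n_absorbing_I_primary_def)
  have absorbing: "(\<Otimes>\<^bsub>R\<^esub>j\<in>{1..n}. b j) \<in> P \<or>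
        (\<exists>i\<in>{1..n}. (\<Otimes>\<^bsub>R\<^esub>j\<in>{1..n + 1} - {i}. b j) \<in> radical R P)"
    if "b \<in> {1..n + 1} \<rightarrow> carrier R"
      "(\<Otimes>\<^bsub>R\<^esub>j\<in>{1..n + 1}. b j) \<in> P - ideal_prod R I P" for b
    using assms(6) that unfolding n_absorbing_I_primary_def by blast
  have "(\<Otimes>\<^bsub>R\<^esub>j\<in>{1..n}. b j) \<in> radical R P \<or>
      (\<exists>i\<in>{1..n}. (\<Otimes>\<^bsub>R\<^esub>j\<in>{1..n + 1} - {i}. b j) \<in> radical R (radical R P))"
    if b: "b \<in> {1..n + 1} \<rightarrow> carrier R"
      and x: "(\<Otimes>\<^bsub>R\<^esub>j\<in>{1..n + 1}. b j) \<in> radical R P - ideal_prod R I (radical R P)" for b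
  proof -
    let ?x = "\<Otimes>\<^bsub>R\<^esub>j\<in>{1..n + 1}. b j"
    from x obtain k :: nat where k: "1 \<le> k" "?x [^]\<^bsub>R\<^esub> k \<in> P" and xc: "?x \<in> carrier R"
      by (blast elim: radicalE)
    have "?x \<notin> radical R (ideal_prod R I P)"
      using x assms(7) by simp
    then have "?x [^]\<^bsub>R\<^esub> k \<notin> ideal_prod R I P"
      using radicalI[OF xc k(1)] by metis
    moreover have pow: "(\<Otimes>\<^bsub>R\<^esub>j\<in>A. b j [^]\<^bsub>R\<^esub> k) = (\<Otimes>\<^bsub>R\<^esub>j\<in>A. b j) [^]\<^bsub>R\<^esub> k"
      and closed: "(\<Otimes>\<^bsub>R\<^esub>j\<in>A. b j) \<in> carrier R" if "A \<subseteq> {1..n + 1}" for A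
    proof -
      have "b \<in> A \<rightarrow> carrier R"
        using b that by blast
      then show "(\<Otimes>\<^bsub>R\<^esub>j\<in>A. b j [^]\<^bsub>R\<^esub> k) = (\<Otimes>\<^bsub>R\<^esub>j\<in>A. b j) [^]\<^bsub>R\<^esub> k"
        "(\<Otimes>\<^bsub>R\<^esub>j\<in>A. b j) \<in> carrier R"
        by (rule finprod_nat_pow, rule finprod_closed)
    qed
    ultimately have "(\<Otimes>\<^bsub>R\<^esub>j\<in>{1..n + 1}. b j [^]\<^bsub>R\<^esub> k) \<in> P - ideal_prod R I P"
      using k(2) by (simp only: pow[OF order_refl] Diff_iff not_False_eq_True simp_thms)
    moreover have "(\<lambda>j. b j [^]\<^bsub>R\<^esub> k) \<in> {1..n + 1} \<rightarrow> carrier R"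
      using b by blast
    ultimately consider "(\<Otimes>\<^bsub>R\<^esub>j\<in>{1..n}. b j [^]\<^bsub>R\<^esub> k) \<in> P"
      | i where "i \<in> {1..n}" "(\<Otimes>\<^bsub>R\<^esub>j\<in>{1..n + 1} - {i}. b j [^]\<^bsub>R\<^esub> k) \<in> radical R P"
      using absorbing[of "\<lambda>j. b j [^]\<^bsub>R\<^esub> k"] by blast
    then show ?thesis
    proof cases
      case 1
      have sub: "{1..n} \<subseteq> {1..n + 1}"
        by auto
      have "(\<Otimes>\<^bsub>R\<^esub>j\<in>{1..n}. b j) \<in> radical R P"
        using closed[OF sub] k(1) 1[unfolded pow[OF sub]] by (rule radicalI)
      then show ?thesis ..
    next
      case (2 i)
      have sub: "{1..n + 1} - {i} \<subseteq> {1..n + 1}"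
        by auto
      have "(\<Otimes>\<^bsub>R\<^esub>j\<in>{1..n + 1} - {i}. b j) \<in> radical R (radical R P)"
        using closed[OF sub] k(1) 2(2)[unfolded pow[OF sub]] by (rule radicalI)
      with 2(1) show ?thesis by blast
    qed
  qed
  then show ?thesis
    using radical_ideal[OF P(1)] radical_proper[OF P]
    unfolding n_absorbing_I_primary_def by blast
qed

end
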